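(* Let $\varepsilon>0$, let $\kappa,\varkappa>0$ and $A=A(\kappa,\varkappa)=\log(\kappa+1)+2\varkappa$. (i) Let $\tau,t_0>0$ be such that $1+t_0<A(\kappa,\varkappa)<1+\tau$, and let $N_0>0$. Then for any $n_1,n_2\in\mathbb{N}_0$ with $n_2\ge N_0$, $$\sup_{\theta\in\mathcal{T}(\tau,t_0,N_0)}\mathrm{E}_\theta\,\mathrm{P}\big(D\notin[d_\tau(\theta)-n_1,\,d_\tau(\theta)+n_2]\,\big|\,X\big)\le\tfrac1\alpha e^{-\alpha n_2}+\tfrac1\beta e^{-\beta n_1},$$ where $\alpha=f_o(A,t_0)>0$ and $\beta=g_o(A,\tau)>0$. (ii) Let $\tau,H_0>0$ be such that $1+\tau<A(\kappa,\varkappa)<1+H_0$, and let $n_0>0$. Then for any $n_1,n_2\in\mathbb{N}_0$ with $n_1\ge n_0$, $$\sup_{\theta\in\mathcal{H}(\tau,H_0,n_0)}\mathrm{E}_\theta\,\mathrm{P}\big(D\notin[d_\tau(\theta)-n_1,\,d_\tau(\theta)+n_2]\,\big|\,X\big)\le\tfrac1\alpha e^{-\alpha n_2}+\tfrac1\beta e^{-\beta n_1},$$ where $\alpha=f_o(A,\tau)>0$ and $\beta=g_o(A,H_0)>0$.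
   Context: $\mathbb{N}=\{1,2,\ldots\}$, $\mathbb{N}_0=\mathbb{N}\cup\{0\}$; $\ell_2$ is the space of square-summable real sequences $\theta=(\theta_i)_{i\in\mathbb{N}}$. The noise level $\varepsilon>0$ is fixed and known. Model: the data are $X=(X_i)_{i\in\mathbb{N}}$ with independent $X_i\sim \mathrm{N}(\theta_i,\varepsilon^2)$, where $\theta\in\ell_2$; $\mathrm{P}_\theta$ and $\mathrm{E}_\theta$ denote the law of $X$ and the expectation with respect to it. Local effective $\tau$-dimension: for $\tau>0$ and $\theta\in\ell_2$, $d_\tau=d_\tau(\theta)\in\mathbb{N}$ is a minimizer over $d\in\mathbb{N}$ of $r_\tau(d,\theta)=\sum_{i>d}\theta_i^2+\tau d\varepsilon^2$ (if there are several minimizers, any fixed choice). Tail condition: for $0<t_0<\tau$ and $N_0>0$, $\mathcal{T}(\tau,t_0,N_0)$ is the set of $\theta\in\ell_2$ such that $\sum_{i=d_\tau+1}^{d_\tau+d}\theta_i^2\le t_0\varepsilon^2 d$ for all $d\in\mathbb{N}$ with $d\ge N_0$. Head condition: for $0<\tau<H_0$ and $n_0>0$, $\mathcal{H}(\tau,H_0,n_0)$ is the set of $\theta\in\ell_2$ such that $\sum_{i=d_\tau-d+1}^{d_\tau}\theta_i^2\ge H_0\varepsilon^2 d$ for all $d\in\mathbb{N}$ with $d_\tau\ge d\ge n_0$. Empirical Bayes posterior on the dimension: for $\kappa,\varkappa>0$ and $d\in\mathbb{N}$, $$\mathrm{P}(D=d|X)=\frac{\lambda_d\prod_i\varphi(X_i,X_i(d),\nu_i^2(d)+\varepsilon^2)}{\sum_{l\in\mathbb{N}}\lambda_l\prod_i\varphi(X_i,X_i(l),\nu_i^2(l)+\varepsilon^2)},$$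 where $\varphi(x,\mu,\sigma^2)$ is the $\mathrm{N}(\mu,\sigma^2)$ density at $x$, $X_i(d)=X_i 1\{i\le d\}$, $\nu_i^2(d)=\kappa\varepsilon^2 1\{i\le d\}$, $\lambda_d=(e^\varkappa-1)e^{-\varkappa d}$. The infinite products are understood by restricting both products to $i\le n$ and letting $n\to\infty$ in the ratio. Explicitly, $\mathrm{P}(D=d|X)=w_d/\sum_{l\in\mathbb{N}}w_l$ with $w_d=\exp\{\tfrac12[\sum_{i=1}^d X_i^2/\varepsilon^2-A d]\}$, $A=A(\kappa,\varkappa)=\log(\kappa+1)+2\varkappa$ (the limit being $0$ if $\sum_l w_l=\infty$). For a set $S$, $\mathrm{P}(D\in S|X)=\sum_{d\in S\cap\mathbb{N}}\mathrm{P}(D=d|X)$, and $\mathrm{P}(D\notin S|X)=\sum_{d\in\mathbb{N}\setminus S}\mathrm{P}(D=d|X)$. For $a,t>0$: $f(h,a,t)=\tfrac12\big(ah+\log(1-h)-\tfrac{th}{1-h}\big)$ for $h<1$, $g(h,a,t)=f(-h,a,t)$ for $h>-1$, $f_o(a,t)=\sup_{h\in[0,1)}f(h,a,t)$, $g_o(a,t)=\sup_{h\in[0,1)}g(h,a,t)$. *)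

theory Defs
  imports "HOL-Probability.Probability"
begin

text \<open>Sequences are indexed by \<open>{1..}\<close>; as elements of the product space they are \<open>undefined\<close> at
  index \<open>0\<close>.\<close>

definition ell2 :: "(nat \<Rightarrow> real) set" where
  "ell2 = {\<theta> \<in> {1..} \<rightarrow>\<^sub>E UNIV. (\<lambda>i. (\<theta> i)\<^sup>2) summable_on {1..}}"

definition seq_law :: "real \<Rightarrow> (nat \<Rightarrow> real) \<Rightarrow> (nat \<Rightarrow> real) measure" where
  "seq_law \<epsilon> \<theta> = (\<Pi>\<^sub>M i\<in>{1..}. density lborel (normal_density (\<theta> i) \<epsilon>))"

definition risk :: "real \<Rightarrow> real \<Rightarrow> (nat \<Rightarrow> real) \<Rightarrow> nat \<Rightarrow> real" where
  "risk \<epsilon> \<tau> \<theta> d = (\<Sum>\<^sub>\<infinity>i\<in>{d<..}. (\<theta> i)\<^sup>2) + \<tau> * real d * \<epsilon>\<^sup>2"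

definition is_effective_dim :: "real \<Rightarrow> real \<Rightarrow> (nat \<Rightarrow> real) \<Rightarrow> nat \<Rightarrow> bool" where
  "is_effective_dim \<epsilon> \<tau> \<theta> d \<longleftrightarrow> is_arg_min (risk \<epsilon> \<tau> \<theta>) (\<lambda>d. 1 \<le> d) d"

text \<open>In the next two definitions \<open>dtau \<tau> \<theta>\<close> is the selected minimizer of \<open>risk \<epsilon> \<tau> \<theta>\<close>.\<close>

definition tail_class ::
  "real \<Rightarrow> (real \<Rightarrow> (nat \<Rightarrow> real) \<Rightarrow> nat) \<Rightarrow> real \<Rightarrow> real \<Rightarrow> real \<Rightarrow> (nat \<Rightarrow> real) set" where
  "tail_class \<epsilon> dtau \<tau> t0 N0 = {\<theta> \<in> ell2. \<forall>d\<ge>1. real d \<ge> N0 \<longrightarrow>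
     (\<Sum>i = dtau \<tau> \<theta> + 1..dtau \<tau> \<theta> + d. (\<theta> i)\<^sup>2) \<le> t0 * \<epsilon>\<^sup>2 * real d}"

definition head_class ::
  "real \<Rightarrow> (real \<Rightarrow> (nat \<Rightarrow> real) \<Rightarrow> nat) \<Rightarrow> real \<Rightarrow> real \<Rightarrow> real \<Rightarrow> (nat \<Rightarrow> real) set" where
  "head_class \<epsilon> dtau \<tau> H0 n0 = {\<theta> \<in> ell2. \<forall>d\<ge>1. dtau \<tau> \<theta> \<ge> d \<and> real d \<ge> n0 \<longrightarrow>
     (\<Sum>i = dtau \<tau> \<theta> - d + 1..dtau \<tau> \<theta>. (\<theta> i)\<^sup>2) \<ge> H0 * \<epsilon>\<^sup>2 * real d}"

text \<open>\<open>gauss x \<mu> v\<close> is parametrised by the variance \<open>v\<close>, whereas \<open>normal_density\<close> takes the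
  standard deviation.\<close>

definition gauss :: "real \<Rightarrow> real \<Rightarrow> real \<Rightarrow> real" where
  "gauss x \<mu> v = normal_density \<mu> (sqrt v) x"

text \<open>Of the two parameters kappa, the prior variance factor is \<open>\<kappa>\<close> and the rate of the
  geometric prior on the dimension is \<open>\<rho>\<close>.\<close>

definition prior_dim :: "real \<Rightarrow> nat \<Rightarrow> real" where
  "prior_dim \<rho> d = (exp \<rho> - 1) * exp (- \<rho> * real d)"

definition prior_mean :: "(nat \<Rightarrow> real) \<Rightarrow> nat \<Rightarrow> nat \<Rightarrow> real" where
  "prior_mean x d i = (if i \<le> d then x i else 0)"

definition prior_var :: "real \<Rightarrow> real \<Rightarrow> nat \<Rightarrow> nat \<Rightarrow> real" where
  "prior_var \<epsilon> \<kappa> d i = (if i \<le> d then \<kappa> * \<epsilon>\<^sup>2 else 0)"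

text \<open>\<open>\<lambda>\<^sub>d\<close> times the marginal likelihood of the first \<open>n\<close> coordinates.\<close>

definition trunc_weight :: "real \<Rightarrow> real \<Rightarrow> real \<Rightarrow> nat \<Rightarrow> (nat \<Rightarrow> real) \<Rightarrow> nat \<Rightarrow> real" where
  "trunc_weight \<epsilon> \<kappa> \<rho> n x d =
     prior_dim \<rho> d * (\<Prod>i=1..n. gauss (x i) (prior_mean x d i) (prior_var \<epsilon> \<kappa> d i + \<epsilon>\<^sup>2))"

definition post_dim :: "real \<Rightarrow> real \<Rightarrow> real \<Rightarrow> (nat \<Rightarrow> real) \<Rightarrow> nat \<Rightarrow> real" where
  "post_dim \<epsilon> \<kappa> \<rho> x d =
     lim (\<lambda>n. trunc_weight \<epsilon> \<kappa> \<rho> n x d / (\<Sum>\<^sub>\<infinity>l\<in>{1..}. trunc_weight \<epsilon> \<kappa> \<rho> n x l))"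

text \<open>\<open>ennreal\<close>-valued, so that neither this sum nor its integral can default to \<open>0\<close>; the interval
  is a set of integers because its left end may be negative.\<close>

definition post_notin :: "real \<Rightarrow> real \<Rightarrow> real \<Rightarrow> (nat \<Rightarrow> real) \<Rightarrow> int set \<Rightarrow> ennreal" where
  "post_notin \<epsilon> \<kappa> \<rho> x S = (\<Sum>\<^sub>\<infinity>d\<in>{d. 1 \<le> d \<and> int d \<notin> S}. ennreal (post_dim \<epsilon> \<kappa> \<rho> x d))"

definition A_const :: "real \<Rightarrow> real \<Rightarrow> real" where
  "A_const \<kappa> \<rho> = ln (\<kappa> + 1) + 2 * \<rho>"

definition f_exp :: "real \<Rightarrow> real \<Rightarrow> real \<Rightarrow> real" where
  "f_exp h a t = (a * h + ln (1 - h) - t * h / (1 - h)) / 2"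

definition g_exp :: "real \<Rightarrow> real \<Rightarrow> real \<Rightarrow> real" where
  "g_exp h a t = f_exp (- h) a t"

definition f_opt :: "real \<Rightarrow> real \<Rightarrow> real" where
  "f_opt a t = (SUP h\<in>{0..<1}. f_exp h a t)"

definition g_opt :: "real \<Rightarrow> real \<Rightarrow> real" where
  "g_opt a t = (SUP h\<in>{0..<1}. g_exp h a t)"

text \<open>The limit in \<open>post_dim\<close> always exists; \<open>post_dim_eq\<close> gives its closed form.\<close>

definition post_weight :: "real \<Rightarrow> real \<Rightarrow> real \<Rightarrow> (nat \<Rightarrow> real) \<Rightarrow> nat \<Rightarrow> real" where
  "post_weight \<epsilon> \<kappa> \<rho> x d = exp (((\<Sum>i=1..d. (x i)\<^sup>2) / \<epsilon>\<^sup>2 - A_const \<kappa> \<rho> * real d) / 2)"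

lemma gauss_ratio:
  assumes "\<epsilon> > 0" "\<kappa> > 0"
  shows "gauss y y (\<kappa> * \<epsilon>\<^sup>2 + \<epsilon>\<^sup>2) =
    normal_density 0 \<epsilon> y * exp ((y\<^sup>2 / \<epsilon>\<^sup>2 - ln (\<kappa> + 1)) / 2)"
proof -
  have e: "exp (- (ln (\<kappa> + 1)) / 2) = 1 / sqrt (\<kappa> + 1)"
    using assms by (simp add: exp_minus exp_ln_iff ln_sqrt[symmetric] inverse_eq_divide)
  have r: "exp ((y\<^sup>2 / \<epsilon>\<^sup>2 - ln (\<kappa> + 1)) / 2) = exp (y\<^sup>2 / (2 * \<epsilon>\<^sup>2)) * (1 / sqrt (\<kappa> + 1))"
    unfolding e[symmetric] exp_add[symmetric] by (simp add: field_simps)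
  have "sqrt (2 * pi * ((\<kappa> + 1) * \<epsilon>\<^sup>2)) = sqrt (2 * pi * \<epsilon>\<^sup>2) * sqrt (\<kappa> + 1)"
    by (simp add: real_sqrt_mult)
  moreover have "\<kappa> * \<epsilon>\<^sup>2 + \<epsilon>\<^sup>2 = (\<kappa> + 1) * \<epsilon>\<^sup>2" by (simp add: algebra_simps)
  moreover have "(\<kappa> + 1) * \<epsilon>\<^sup>2 \<ge> 0" using assms by simp
  ultimately have "gauss y y (\<kappa> * \<epsilon>\<^sup>2 + \<epsilon>\<^sup>2) = 1 / sqrt (2 * pi * \<epsilon>\<^sup>2) * (1 / sqrt (\<kappa> + 1))"
    unfolding gauss_def normal_density_def by simp
  moreover have "normal_density 0 \<epsilon> y * exp (y\<^sup>2 / (2 * \<epsilon>\<^sup>2)) = 1 / sqrt (2 * pi * \<epsilon>\<^sup>2)"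
    unfolding normal_density_def by (simp add: exp_minus)
  ultimately show ?thesis unfolding r mult.assoc[symmetric] by simp
qed

lemma trunc_weight_eq:
  assumes "\<epsilon> > 0" "\<kappa> > 0"
  shows "trunc_weight \<epsilon> \<kappa> \<rho> n x l = (exp \<rho> - 1) * (\<Prod>i=1..n. normal_density 0 \<epsilon> (x i)) *
    (post_weight \<epsilon> \<kappa> \<rho> x (min l n) * exp (- \<rho> * real (l - min l n)))"
proof -
  let ?m = "min l n"
  let ?r = "\<lambda>i. exp (((x i)\<^sup>2 / \<epsilon>\<^sup>2 - ln (\<kappa> + 1)) / 2)"
  have "(\<Prod>i=1..n. gauss (x i) (prior_mean x l i) (prior_var \<epsilon> \<kappa> l i + \<epsilon>\<^sup>2)) =
    (\<Prod>i=1..n. normal_density 0 \<epsilon> (x i) * (if i \<le> l then ?r i else 1))"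
    by (intro prod.cong refl, simp add: prior_mean_def prior_var_def gauss_ratio[OF assms])
       (use assms in \<open>simp add: gauss_def\<close>)
  also have "\<dots> = (\<Prod>i=1..n. normal_density 0 \<epsilon> (x i)) * (\<Prod>i=1..n. if i \<le> l then ?r i else 1)"
    by (rule prod.distrib)
  also have "(\<Prod>i=1..n. if i \<le> l then ?r i else 1) = (\<Prod>i=1..?m. ?r i)"
    by (rule prod.mono_neutral_cong_right) auto
  also have "\<dots> = exp (((\<Sum>i=1..?m. (x i)\<^sup>2) / \<epsilon>\<^sup>2 - ln (\<kappa> + 1) * real ?m) / 2)"
    by (simp add: exp_sum[symmetric] sum_divide_distrib[symmetric] sum_subtractf mult.commute)
  finally have P: "(\<Prod>i=1..n. gauss (x i) (prior_mean x l i) (prior_var \<epsilon> \<kappa> l i + \<epsilon>\<^sup>2)) =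
    (\<Prod>i=1..n. normal_density 0 \<epsilon> (x i)) * exp (((\<Sum>i=1..?m. (x i)\<^sup>2) / \<epsilon>\<^sup>2 - ln (\<kappa> + 1) * real ?m) / 2)" .
  have "exp (- \<rho> * real l) * exp (((\<Sum>i=1..?m. (x i)\<^sup>2) / \<epsilon>\<^sup>2 - ln (\<kappa> + 1) * real ?m) / 2)
    = post_weight \<epsilon> \<kappa> \<rho> x ?m * exp (- \<rho> * real (l - ?m))"
    unfolding post_weight_def A_const_def exp_add[symmetric]
    by (simp add: of_nat_diff field_simps)
  then show ?thesis unfolding trunc_weight_def prior_dim_def P
    by (simp add: mult.assoc mult.left_commute)
qed

lemma post_dim_eq:
  fixes x :: "nat \<Rightarrow> real"
  assumes "\<epsilon> > 0" "\<kappa> > 0" "\<rho> > 0" "1 \<le> d"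
  defines "w \<equiv> post_weight \<epsilon> \<kappa> \<rho> x"
  shows "post_dim \<epsilon> \<kappa> \<rho> x d = (if w summable_on {1..} then w d / (\<Sum>\<^sub>\<infinity>l\<in>{1..}. w l) else 0)"
proof -
  define c where "c = 1 / (exp \<rho> - 1)"
  define S where "S n = (\<Sum>l=1..n. w l)" for n
  have c: "c > 0" using assms by (simp add: c_def)
  have w: "w l > 0" for l by (simp add: w_def post_weight_def)
  have geo: "((\<lambda>l. exp (- \<rho> * real (l - n))) has_sum c) {n<..}" for n
  proof -
    have "(\<lambda>k. exp (- \<rho>) * exp (- \<rho>) ^ k) sums (exp (- \<rho>) * (1 / (1 - exp (- \<rho>))))"
      by (intro sums_mult geometric_sums) (use assms in simp)
    also have "exp (- \<rho>) * (1 / (1 - exp (- \<rho>))) = c"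
      using assms by (simp add: c_def exp_minus field_simps)
    finally have "((\<lambda>k. exp (- \<rho>) * exp (- \<rho>) ^ k) has_sum c) UNIV"
      by (intro sums_nonneg_imp_has_sum) auto
    also have "(\<lambda>k. exp (- \<rho>) * exp (- \<rho>) ^ k) = (\<lambda>k. exp (- \<rho> * real (k + Suc n - n)))"
      by (auto simp: exp_of_nat_mult[symmetric] exp_add[symmetric] algebra_simps)
    finally show ?thesis
      by (rule has_sum_reindex_bij_witness[of _ "\<lambda>l. l - Suc n" "\<lambda>k. k + Suc n", THEN iffD1, rotated -1]) auto
  qed
  have den: "((\<lambda>l. w (min l n) * exp (- \<rho> * real (l - min l n))) has_sum (S n + w n * c)) {1..}" for n
  proof -
    have "((\<lambda>l. w (min l n) * exp (- \<rho> * real (l - min l n))) has_sum S n) {1..n}"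
      unfolding S_def by (intro has_sum_finiteI) (auto intro!: sum.cong)
    moreover have "((\<lambda>l. w (min l n) * exp (- \<rho> * real (l - min l n))) has_sum w n * c) {n<..} \<longleftrightarrow>
        ((\<lambda>l. w n * exp (- \<rho> * real (l - n))) has_sum w n * c) {n<..}"
      by (intro has_sum_cong) auto
    then have "((\<lambda>l. w (min l n) * exp (- \<rho> * real (l - min l n))) has_sum w n * c) {n<..}"
      using has_sum_cmult_right[OF geo] by blast
    ultimately have "((\<lambda>l. w (min l n) * exp (- \<rho> * real (l - min l n))) has_sum (S n + w n * c)) ({1..n} \<union> {n<..})"
      by (intro has_sum_Un_disjoint) auto
    moreover have "(if n = 0 then {1..} else {1..n} \<union> {n<..}) = {1..}" by auto
    ultimately show ?thesis by (cases "n = 0") (auto simp: atLeast_Suc_greaterThan)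
  qed
  have ev: "eventually (\<lambda>n. trunc_weight \<epsilon> \<kappa> \<rho> n x d / (\<Sum>\<^sub>\<infinity>l\<in>{1..}. trunc_weight \<epsilon> \<kappa> \<rho> n x l)
      = w d / (S n + w n * c)) sequentially"
  proof (rule eventually_sequentiallyI[of d])
    fix n assume n: "d \<le> n"
    let ?K = "(exp \<rho> - 1) * (\<Prod>i=1..n. normal_density 0 \<epsilon> (x i))"
    have K: "?K > 0" using assms by (intro mult_pos_pos prod_pos) (auto intro!: normal_density_pos)
    have tw: "trunc_weight \<epsilon> \<kappa> \<rho> n x l = ?K * (w (min l n) * exp (- \<rho> * real (l - min l n)))" for l
      unfolding w_def by (rule trunc_weight_eq) (use assms in auto)
    have "(\<Sum>\<^sub>\<infinity>l\<in>{1..}. trunc_weight \<epsilon> \<kappa> \<rho> n x l) = ?K * (S n + w n * c)"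
      unfolding tw by (intro infsumI has_sum_cmult_right den)
    moreover have "trunc_weight \<epsilon> \<kappa> \<rho> n x d = ?K * w d" using n by (simp add: tw)
    ultimately show "trunc_weight \<epsilon> \<kappa> \<rho> n x d / (\<Sum>\<^sub>\<infinity>l\<in>{1..}. trunc_weight \<epsilon> \<kappa> \<rho> n x l)
      = w d / (S n + w n * c)" using K by (simp only: mult_divide_mult_cancel_left[OF less_imp_neq[OF K, symmetric]])
  qed
  have S_eq: "S = (\<lambda>n. \<Sum>l<n. w (Suc l))"
    unfolding S_def by (simp add: sum.atLeast1_atMost_eq)
  have sm: "w summable_on {1..} \<longleftrightarrow> summable (\<lambda>l. w (Suc l))"
  proof -
    have "w summable_on {1..} \<longleftrightarrow> (\<lambda>l. w (Suc l)) summable_on UNIV"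
      by (rule summable_on_reindex_bij_witness[of _ Suc "\<lambda>l. l - 1"]) auto
    also have "\<dots> \<longleftrightarrow> summable (\<lambda>l. w (Suc l))"
      by (rule summable_on_UNIV_nonneg_real_iff) (simp add: w less_imp_le)
    finally show ?thesis .
  qed
  have "(\<lambda>n. w d / (S n + w n * c)) \<longlonglongrightarrow>
    (if w summable_on {1..} then w d / (\<Sum>\<^sub>\<infinity>l\<in>{1..}. w l) else 0)"
  proof (cases "w summable_on {1..}")
    case True
    then have su: "summable (\<lambda>l. w (Suc l))" using sm by simp
    have "infsum w {1..} = infsum (\<lambda>l. w (Suc l)) UNIV"
      by (rule infsum_reindex_bij_witness[of _ Suc "\<lambda>l. l - 1"]) auto
    also have "\<dots> = suminf (\<lambda>l. w (Suc l))"
      by (intro infsumI sums_nonneg_imp_has_sum summable_sums su) (simp add: w less_imp_le)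
    finally have "S \<longlonglongrightarrow> infsum w {1..}" "infsum w {1..} > 0"
      unfolding S_eq using summable_LIMSEQ[OF su] suminf_pos[OF su] w by auto
    moreover have "w \<longlonglongrightarrow> 0" using summable_LIMSEQ_zero[OF su] by (rule LIMSEQ_imp_Suc)
    ultimately have "(\<lambda>n. w d / (S n + w n * c)) \<longlonglongrightarrow> w d / (infsum w {1..} + 0 * c)"
      by (intro tendsto_intros) auto
    then show ?thesis using True by simp
  next
    case False
    then have "\<not> summable (\<lambda>l. w (Suc l))" using sm by simp
    then have "filterlim S at_top sequentially"
      unfolding filterlim_at_top
    proof (intro allI)
      fix Z :: real
      obtain N where "S N > Z"
        using summableI_nonneg_bounded[of "\<lambda>l. w (Suc l)" Z] \<open>\<not> summable _\<close> w
        unfolding S_eq by (meson less_imp_le not_le)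
      moreover have "S N \<le> S n" if "n \<ge> N" for n
        unfolding S_def by (intro sum_mono2) (use that w in \<open>auto simp: less_imp_le\<close>)
      ultimately show "eventually (\<lambda>n. Z \<le> S n) sequentially"
        by (meson eventually_sequentiallyI less_imp_le order_trans)
    qed
    then have "filterlim (\<lambda>n. S n + w n * c) at_top sequentially"
      by (rule filterlim_at_top_mono) (use w c in \<open>auto simp: less_imp_le\<close>)
    then show ?thesis using False
      by (auto intro!: tendsto_divide_0[OF tendsto_const] filterlim_at_top_imp_at_infinity)
  qed
  then have "(\<lambda>n. trunc_weight \<epsilon> \<kappa> \<rho> n x d / (\<Sum>\<^sub>\<infinity>l\<in>{1..}. trunc_weight \<epsilon> \<kappa> \<rho> n x l)) \<longlonglongrightarrow>
    (if w summable_on {1..} then w d / (\<Sum>\<^sub>\<infinity>l\<in>{1..}. w l) else 0)"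
    using tendsto_cong[OF ev] by blast
  then show ?thesis unfolding post_dim_def by (rule limI)
qed

end

theory Submission
  imports Defs
begin

text \<open>Write \<open>d0\<close> for the effective dimension and \<open>w d\<close> for the posterior weights. Since
  \<open>P(D = d | X) \<le> min 1 (w d / w d0) \<le> (w d / w d0) ^ h\<close> for every \<open>0 \<le> h < 1\<close>, the Gaussian
  exponential moment of \<open>(w d / w d0) ^ h\<close> gives a Chernoff bound \<open>exp (- \<bar>d - d0\<bar> * f_exp h a t)\<close>
  for \<open>d > d0\<close>, and the same with \<open>f_exp (- h) a t\<close> for \<open>d < d0\<close>, as soon as the energy of \<open>\<theta>\<close>
  between \<open>d\<close> and \<open>d0\<close> is at most, respectively at least, \<open>t * \<epsilon>\<^sup>2 * \<bar>d - d0\<bar>\<close>. Minimality of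
  \<open>d0\<close> provides one of the two energy bounds with \<open>t = \<tau>\<close>; the tail or head condition provides
  the other. It remains to optimise over \<open>h\<close> and to sum a geometric series.\<close>

section \<open>Boundedness and positivity of the exponential rates\<close>

text \<open>A real \<open>SUP\<close> dominates its members only if they are bounded above; this
  lemma and the next secure that for \<open>f_opt\<close> and \<open>g_opt\<close>.\<close>

lemma bdd_above_f_exp:
  assumes "a > 0" "t > 0"
  shows "bdd_above ((\<lambda>h. f_exp h a t) ` {0..<1})"
proof (rule bdd_aboveI2)
  fix h :: real assume h: "h \<in> {0..<1}"
  have "a * h \<le> a" using h assms by (simp add: mult_left_le)
  moreover have "ln (1 - h) \<le> 0" using h by simp
  moreover have "t * h / (1 - h) \<ge> 0" using h assms by simp
  ultimately show "f_exp h a t \<le> a / 2" unfolding f_exp_def by simp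
qed

lemma bdd_above_g_exp:
  assumes "a > 0" "t > 0"
  shows "bdd_above ((\<lambda>h. g_exp h a t) ` {0..<1})"
proof (rule bdd_aboveI2)
  fix h :: real assume h: "h \<in> {0..<1}"
  have "a * h \<ge> 0" using h assms by simp
  moreover have "ln (1 + h) \<le> 1" using h ln_add_one_self_le_self[of h] by simp
  moreover have "t * (h / (1 + h)) \<le> t * 1" using h assms by (intro mult_left_mono) auto
  moreover have "g_exp h a t = (- (a * h) + ln (1 + h) + t * (h / (1 + h))) / 2"
    unfolding g_exp_def f_exp_def by simp
  ultimately show "g_exp h a t \<le> (1 + t) / 2" by argo
qed

text \<open>The slopes at h = 0 are where the strict inequalities between a and 1 + t enter: f rises
  from 0 when 1 + t < a, and g rises from 0 when a < 1 + t.\<close>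

lemma f_exp_has_real_derivative_0:
  "((\<lambda>h. f_exp h a t) has_real_derivative (a - 1 - t) / 2) (at 0)"
  unfolding f_exp_def by (auto intro!: derivative_eq_intros simp: field_simps)

lemma g_exp_has_real_derivative_0:
  "((\<lambda>h. g_exp h a t) has_real_derivative (1 + t - a) / 2) (at 0)"
  unfolding g_exp_def f_exp_def by (auto intro!: derivative_eq_intros simp: field_simps)

text \<open>A positive slope at the zero h = 0 forces a positive value at some small h > 0, and the
  supremum is at least that value.\<close>

lemma cSUP_pos_of_deriv_pos:
  fixes \<phi> :: "real \<Rightarrow> real"
  assumes "(\<phi> has_real_derivative l) (at 0)" "l > 0" "\<phi> 0 = 0" "bdd_above (\<phi> ` {0..<1})"
  shows "(SUP h\<in>{0..<1}. \<phi> h) > 0"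
proof -
  obtain \<delta> where "\<delta> > 0" and inc: "\<And>h. 0 < h \<Longrightarrow> h < \<delta> \<Longrightarrow> \<phi> 0 < \<phi> (0 + h)"
    using DERIV_pos_inc_right[OF assms(1,2)] by blast
  \<comment> \<open>Halving keeps h strictly below both \<delta> and 1, hence inside the half-open
    index set.\<close>
  define h where "h = min \<delta> 1 / 2"
  have h: "0 < h" "h < \<delta>" "h < 1" using \<open>\<delta> > 0\<close> by (auto simp: h_def min_def)
  then have "0 < \<phi> h" using inc[of h] assms(3) by simp
  also have "\<dots> \<le> (SUP h\<in>{0..<1}. \<phi> h)" using h by (intro cSUP_upper assms(4)) auto
  finally show ?thesis .
qed

lemma f_opt_pos:
  assumes "t > 0" "1 + t < a"
  shows "f_opt a t > 0"
  unfolding f_opt_def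
  by (rule cSUP_pos_of_deriv_pos[OF f_exp_has_real_derivative_0 _ _ bdd_above_f_exp])
     (use assms in \<open>auto simp: f_exp_def\<close>)

lemma g_opt_pos:
  assumes "a > 0" "t > 0" "a < 1 + t"
  shows "g_opt a t > 0"
  unfolding g_opt_def
  by (rule cSUP_pos_of_deriv_pos[OF g_exp_has_real_derivative_0 _ _ bdd_above_g_exp])
     (use assms in \<open>auto simp: g_exp_def f_exp_def\<close>)

section \<open>Optimising the exponent and summing series\<close>

text \<open>The bound passes to the supremum even if no h attains it: after taking logarithms, one
  number bounds every \<phi> h from above, hence also their supremum.\<close>

lemma le_exp_cSUP:
  fixes c :: ennreal and \<phi> :: "real \<Rightarrow> real"
  assumes "H \<noteq> {}" "k > 0" and le: "\<And>h. h \<in> H \<Longrightarrow> c \<le> ennreal (exp (- k * \<phi> h))"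
  shows "c \<le> ennreal (exp (- k * (SUP h\<in>H. \<phi> h)))"
proof -
  \<comment> \<open>A single index makes c finite, hence a real r. For r = 0 there is no logarithm
    to take, but the claim is trivial.\<close>
  obtain h0 where "h0 \<in> H" using assms by blast
  then have "c < \<top>" using le le_less_trans ennreal_less_top by blast
  then obtain r where r: "c = ennreal r" "r \<ge> 0" by (cases c) auto
  show ?thesis
  proof (cases "r = 0")
    case False
    then have "r > 0" using r by simp
    have "\<phi> h \<le> - ln r / k" if "h \<in> H" for h
    proof -
      have "r \<le> exp (- k * \<phi> h)" using le[OF that] r by simp
      then have "ln r \<le> - k * \<phi> h" using \<open>r > 0\<close> by (metis exp_gt_zero ln_exp ln_le_cancel_iff)
      then show ?thesis using \<open>k > 0\<close> by (simp add: field_simps)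
    qed
    then have "(SUP h\<in>H. \<phi> h) \<le> - ln r / k" by (intro cSUP_least assms(1)) auto
    then have "ln r \<le> - k * (SUP h\<in>H. \<phi> h)" using \<open>k > 0\<close> by (simp add: field_simps)
    then show ?thesis using r \<open>r > 0\<close>
      by (metis ennreal_leI exp_le_cancel_iff exp_ln)
  qed (use r in simp)
qed

text \<open>The factor 1 / a comes from 1 + a \<le> exp a: a times each term is at most a difference
  of consecutive exponentials, and these telescope. Finite K suffices because the series is later
  bounded through its partial sums.\<close>

lemma sum_exp_tail_le:
  fixes a :: real
  assumes "a > 0" "finite K" "K \<subseteq> {n<..}"
  shows "(\<Sum>k\<in>K. exp (- a * real k)) \<le> 1 / a * exp (- a * real n)"
proof -
  have step: "a * exp (- a * real (Suc k)) \<le> exp (- a * real k) - exp (- a * real (Suc k))" for k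
  proof -
    have "(1 + a) * exp (- a * real (Suc k)) \<le> exp a * exp (- a * real (Suc k))"
      by (intro mult_right_mono) auto
    also have "\<dots> = exp (- a * real k)" by (simp add: exp_add[symmetric] algebra_simps)
    finally show ?thesis by (simp add: algebra_simps)
  qed
  have tel: "a * (\<Sum>k=Suc n..n+m. exp (- a * real k)) \<le> exp (- a * real n) - exp (- a * real (n + m))" for m
  proof (induction m)
    case (Suc m)
    then show ?case using step[of "n + m"] by (simp add: distrib_left)
  qed simp
  obtain m where m: "K \<subseteq> {..m}" using assms(2) finite_nat_iff_bounded_le by blast
  have "(\<Sum>k\<in>K. exp (- a * real k)) \<le> (\<Sum>k=Suc n..n+m. exp (- a * real k))"
  proof (intro sum_mono2)
    show "K \<subseteq> {Suc n..n + m}" using m assms(3) by (fastforce simp: subset_iff)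
  qed auto
  also have "\<dots> \<le> 1 / a * exp (- a * real n)"
    using tel[of m] \<open>a > 0\<close> by (simp add: field_simps) (smt (verit) exp_gt_zero)
  finally show ?thesis .
qed

text \<open>Turns the unordered sum in \<open>post_notin\<close> into a series, so that sum and
  integral can be exchanged by \<open>nn_integral_suminf\<close>.\<close>

lemma infsum_ennreal_eq_suminf:
  fixes f :: "nat \<Rightarrow> ennreal"
  shows "infsum f I = (\<Sum>d. if d \<in> I then f d else 0)"
proof -
  have "infsum f I = infsum (\<lambda>d. if d \<in> I then f d else 0) UNIV"
    by (rule infsum_cong_neutral) auto
  moreover have "((\<lambda>d. if d \<in> I then f d else 0) has_sum infsum (\<lambda>d. if d \<in> I then f d else 0) UNIV) UNIV"
    by (intro has_sum_infsum nonneg_summable_on_complete) auto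
  ultimately show ?thesis using has_sum_imp_sums sums_unique by fastforce
qed

section \<open>Gaussian exponential moments\<close>

text \<open>Complete the square: the tilted normal density is a constant times another normal
  density, which has mass one. Negative s is included, as dimensions below d0 require it.\<close>

lemma nn_integral_exp_square_normal:
  fixes \<epsilon> \<mu> s :: real
  assumes "\<epsilon> > 0" "s < 1"
  shows "(\<integral>\<^sup>+y. ennreal (exp (s * y\<^sup>2 / (2 * \<epsilon>\<^sup>2))) \<partial>density lborel (normal_density \<mu> \<epsilon>))
    = ennreal (exp (s * \<mu>\<^sup>2 / (2 * \<epsilon>\<^sup>2 * (1 - s)) - ln (1 - s) / 2))" (is "_ = ennreal ?C")
proof -
  \<comment> \<open>Tilting divides the variance by 1 - s, which is positive, and moves the mean to
    \<open>\<mu> / (1 - s)\<close>.\<close>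
  define \<sigma> where "\<sigma> = \<epsilon> / sqrt (1 - s)"
  have \<sigma>: "\<sigma> > 0" "\<sigma>\<^sup>2 = \<epsilon>\<^sup>2 / (1 - s)" using assms by (auto simp: \<sigma>_def power_divide)
  have "normal_density \<mu> \<epsilon> y * exp (s * y\<^sup>2 / (2 * \<epsilon>\<^sup>2)) = ?C * normal_density (\<mu> / (1 - s)) \<sigma> y" for y
  proof -
    have c: "exp (- ln (1 - s) / 2) = 1 / sqrt (1 - s)"
      using assms by (simp add: exp_minus ln_sqrt[symmetric] inverse_eq_divide)
    have "sqrt (2 * pi * \<sigma>\<^sup>2) = sqrt (2 * pi * \<epsilon>\<^sup>2) / sqrt (1 - s)"
      unfolding \<sigma> by (simp add: real_sqrt_divide[symmetric])
    then have n: "1 / sqrt (1 - s) * (1 / sqrt (2 * pi * \<sigma>\<^sup>2)) = 1 / sqrt (2 * pi * \<epsilon>\<^sup>2)"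
      using assms by simp
    have e: "- (y - \<mu>)\<^sup>2 / (2 * \<epsilon>\<^sup>2) + s * y\<^sup>2 / (2 * \<epsilon>\<^sup>2)
      = s * \<mu>\<^sup>2 / (2 * \<epsilon>\<^sup>2 * (1 - s)) + - (y - \<mu> / (1 - s))\<^sup>2 / (2 * \<sigma>\<^sup>2)"
    proof -
      have "- (y - \<mu>)\<^sup>2 + s * y\<^sup>2 = s * \<mu>\<^sup>2 / (1 - s) - (1 - s) * (y - \<mu> / (1 - s))\<^sup>2"
        using assms by (simp add: divide_simps) (simp add: power2_eq_square algebra_simps)
      then have "(- (y - \<mu>)\<^sup>2 + s * y\<^sup>2) / (2 * \<epsilon>\<^sup>2) =
        (s * \<mu>\<^sup>2 / (1 - s) - (1 - s) * (y - \<mu> / (1 - s))\<^sup>2) / (2 * \<epsilon>\<^sup>2)" by simp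
      then show ?thesis unfolding \<sigma> using assms by (simp add: add_divide_distrib diff_divide_distrib ac_simps)
    qed
    have "normal_density \<mu> \<epsilon> y * exp (s * y\<^sup>2 / (2 * \<epsilon>\<^sup>2))
      = 1 / sqrt (2 * pi * \<epsilon>\<^sup>2) * exp (- (y - \<mu>)\<^sup>2 / (2 * \<epsilon>\<^sup>2) + s * y\<^sup>2 / (2 * \<epsilon>\<^sup>2))"
      by (simp only: normal_density_def exp_add mult.assoc)
    also have "\<dots> = exp (s * \<mu>\<^sup>2 / (2 * \<epsilon>\<^sup>2 * (1 - s))) * (1 / sqrt (1 - s)) *
        (1 / sqrt (2 * pi * \<sigma>\<^sup>2) * exp (- (y - \<mu> / (1 - s))\<^sup>2 / (2 * \<sigma>\<^sup>2)))"
      unfolding e exp_add n[symmetric] by (simp only: ac_simps)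
    also have "\<dots> = ?C * normal_density (\<mu> / (1 - s)) \<sigma> y"
      unfolding c[symmetric] normal_density_def exp_add[symmetric] by simp
    finally show ?thesis .
  qed
  then have "(\<integral>\<^sup>+y. ennreal (exp (s * y\<^sup>2 / (2 * \<epsilon>\<^sup>2))) \<partial>density lborel (normal_density \<mu> \<epsilon>))
    = (\<integral>\<^sup>+y. ennreal ?C * ennreal (normal_density (\<mu> / (1 - s)) \<sigma> y) \<partial>lborel)"
    by (subst nn_integral_density) (auto simp: ennreal_mult[symmetric])
  also have "\<dots> = ennreal ?C * (\<integral>\<^sup>+y. ennreal (normal_density (\<mu> / (1 - s)) \<sigma> y) \<partial>lborel)"
    by (rule nn_integral_cmult) simp
  also have "(\<integral>\<^sup>+y. ennreal (normal_density (\<mu> / (1 - s)) \<sigma> y) \<partial>lborel) = 1"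
    using \<sigma> integral_normal_density[of \<sigma>] integrable_normal_density[of \<sigma>]
    by (subst nn_integral_eq_integral) auto
  finally show ?thesis by simp
qed

lemma measurable_seq_law_component [measurable]:
  "i \<ge> 1 \<Longrightarrow> (\<lambda>x. x i) \<in> borel_measurable (seq_law \<epsilon> \<theta>)"
  unfolding seq_law_def
  using measurable_component_singleton[of i "{1..}" "\<lambda>i. density lborel (normal_density (\<theta> i) \<epsilon>)"]
  by simp

text \<open>This is independence: the integrand sees only the coordinates in J, so the infinite
  product may be replaced by its marginal on J, a finite product measure, where the integral
  factorises.\<close>

lemma nn_integral_seq_law_prod:
  fixes g :: "nat \<Rightarrow> real \<Rightarrow> ennreal"
  assumes "\<epsilon> > 0" "finite J" "J \<subseteq> {1..}" and [measurable]: "\<And>i. i \<in> J \<Longrightarrow> g i \<in> borel_measurable borel"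
  shows "(\<integral>\<^sup>+x. (\<Prod>i\<in>J. g i (x i)) \<partial>seq_law \<epsilon> \<theta>)
    = (\<Prod>i\<in>J. \<integral>\<^sup>+y. g i y \<partial>density lborel (normal_density (\<theta> i) \<epsilon>))"
proof -
  let ?M = "\<lambda>i. density lborel (\<lambda>y. ennreal (normal_density (\<theta> i) \<epsilon> y))"
  interpret product_prob_space ?M "{1..}"
    by (intro product_prob_spaceI prob_space_normal_density assms(1))
  have [measurable]: "g i \<in> borel_measurable (?M i)" if "i \<in> J" for i using that by simp
  have "(\<Prod>i\<in>J. integral\<^sup>N (?M i) (g i)) = (\<integral>\<^sup>+x. (\<Prod>i\<in>J. g i (x i)) \<partial>Pi\<^sub>M J ?M)"
    by (rule product_nn_integral_prod[symmetric]) (use assms in auto)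
  also have "\<dots> = (\<integral>\<^sup>+x. (\<Prod>i\<in>J. g i (x i)) \<partial>distr (Pi\<^sub>M {1..} ?M) (Pi\<^sub>M J ?M) (\<lambda>x. restrict x J))"
    by (subst distr_PiM_restrict_finite) (use assms in auto)
  also have "\<dots> = (\<integral>\<^sup>+x. (\<Prod>i\<in>J. g i (restrict x J i)) \<partial>Pi\<^sub>M {1..} ?M)"
  proof (intro nn_integral_distr)
    show "(\<lambda>x. restrict x J) \<in> measurable (Pi\<^sub>M {1..} ?M) (Pi\<^sub>M J ?M)"
      by (intro measurable_restrict_subset assms)
    show "(\<lambda>x. \<Prod>i\<in>J. g i (x i)) \<in> borel_measurable (distr (Pi\<^sub>M {1..} ?M) (Pi\<^sub>M J ?M) (\<lambda>x. restrict x J))"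
      unfolding measurable_distr_eq1
    proof (intro borel_measurable_prod_ennreal)
      fix i assume i: "i \<in> J"
      show "(\<lambda>x. g i (x i)) \<in> borel_measurable (Pi\<^sub>M J ?M)"
        by (rule measurable_compose[OF measurable_component_singleton[OF i]]) (use i in measurable)
    qed
  qed
  also have "\<dots> = (\<integral>\<^sup>+x. (\<Prod>i\<in>J. g i (x i)) \<partial>seq_law \<epsilon> \<theta>)"
    unfolding seq_law_def by (intro nn_integral_cong prod.cong) auto
  finally show ?thesis by simp
qed

text \<open>The sign of \<open>s\<close> decides whether the energy hypothesis is an upper or a lower bound.\<close>

lemma nn_integral_exp_excess_le:
  fixes \<epsilon> s a t :: real
  assumes "\<epsilon> > 0" "s < 1" "finite J" "J \<subseteq> {1..}"
    and energy: "s * (\<Sum>i\<in>J. (\<theta> i)\<^sup>2) \<le> s * (t * \<epsilon>\<^sup>2 * real (card J))"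
  shows "(\<integral>\<^sup>+x. ennreal (exp (s / 2 * ((\<Sum>i\<in>J. (x i)\<^sup>2) / \<epsilon>\<^sup>2 - a * real (card J)))) \<partial>seq_law \<epsilon> \<theta>)
    \<le> ennreal (exp (- real (card J) * f_exp s a t))"
proof -
  let ?k = "real (card J)"
  let ?c = "exp (- s * a * ?k / 2)"
  \<comment> \<open>The term with \<open>card J\<close> does not depend on x; pulled out, it leaves
    a product over independent coordinates.\<close>
  have eq: "exp (s / 2 * ((\<Sum>i\<in>J. (x i)\<^sup>2) / \<epsilon>\<^sup>2 - a * ?k))
    = ?c * (\<Prod>i\<in>J. exp (s * (x i)\<^sup>2 / (2 * \<epsilon>\<^sup>2)))" for x :: "nat \<Rightarrow> real"
  proof -
    have "(\<Sum>i\<in>J. s * (x i)\<^sup>2 / (2 * \<epsilon>\<^sup>2)) = s / 2 * ((\<Sum>i\<in>J. (x i)\<^sup>2) / \<epsilon>\<^sup>2)"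
      by (simp add: sum_divide_distrib sum_distrib_left)
    then show ?thesis using assms(3) by (simp add: exp_sum[symmetric] exp_add[symmetric] algebra_simps)
  qed
  have "(\<integral>\<^sup>+x. ennreal (exp (s / 2 * ((\<Sum>i\<in>J. (x i)\<^sup>2) / \<epsilon>\<^sup>2 - a * ?k))) \<partial>seq_law \<epsilon> \<theta>)
    = (\<integral>\<^sup>+x. ennreal ?c * (\<Prod>i\<in>J. ennreal (exp (s * (x i)\<^sup>2 / (2 * \<epsilon>\<^sup>2)))) \<partial>seq_law \<epsilon> \<theta>)"
    unfolding eq by (simp add: ennreal_mult prod_nonneg prod_ennreal)
  also have "\<dots> = ennreal ?c * (\<integral>\<^sup>+x. (\<Prod>i\<in>J. ennreal (exp (s * (x i)\<^sup>2 / (2 * \<epsilon>\<^sup>2)))) \<partial>seq_law \<epsilon> \<theta>)"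
  proof (intro nn_integral_cmult borel_measurable_prod_ennreal)
    fix i assume "i \<in> J"
    then have [measurable]: "(\<lambda>x. x i) \<in> borel_measurable (seq_law \<epsilon> \<theta>)" using assms(4) by auto
    show "(\<lambda>x. ennreal (exp (s * (x i)\<^sup>2 / (2 * \<epsilon>\<^sup>2)))) \<in> borel_measurable (seq_law \<epsilon> \<theta>)"
      by measurable
  qed
  also have "(\<integral>\<^sup>+x. (\<Prod>i\<in>J. ennreal (exp (s * (x i)\<^sup>2 / (2 * \<epsilon>\<^sup>2)))) \<partial>seq_law \<epsilon> \<theta>)
    = (\<Prod>i\<in>J. ennreal (exp (s * (\<theta> i)\<^sup>2 / (2 * \<epsilon>\<^sup>2 * (1 - s)) - ln (1 - s) / 2)))"
    by (subst nn_integral_seq_law_prod[where g = "\<lambda>i y. ennreal (exp (s * y\<^sup>2 / (2 * \<epsilon>\<^sup>2)))"])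
       (use assms in \<open>auto simp: nn_integral_exp_square_normal\<close>)
  also have "\<dots> = ennreal (exp (\<Sum>i\<in>J. s * (\<theta> i)\<^sup>2 / (2 * \<epsilon>\<^sup>2 * (1 - s)) - ln (1 - s) / 2))"
    using assms(3) by (simp add: prod_ennreal exp_sum)
  also have "(\<Sum>i\<in>J. s * (\<theta> i)\<^sup>2 / (2 * \<epsilon>\<^sup>2 * (1 - s)) - ln (1 - s) / 2)
    = s * (\<Sum>i\<in>J. (\<theta> i)\<^sup>2) / (2 * \<epsilon>\<^sup>2 * (1 - s)) - ?k * (ln (1 - s) / 2)"
    by (simp add: sum_subtractf sum_distrib_left sum_divide_distrib)
  also have "ennreal ?c * ennreal (exp \<dots>) =
      ennreal (exp (- s * a * ?k / 2 + (s * (\<Sum>i\<in>J. (\<theta> i)\<^sup>2) / (2 * \<epsilon>\<^sup>2 * (1 - s)) - ?k * (ln (1 - s) / 2))))"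
    by (simp only: exp_add ennreal_mult[symmetric] exp_ge_zero)
  also have "\<dots> \<le> ennreal (exp (- ?k * f_exp s a t))"
  proof -
    \<comment> \<open>The energy hypothesis enters only here. The divisor is positive, so the
      direction is kept for either sign of s.\<close>
    have "s * (\<Sum>i\<in>J. (\<theta> i)\<^sup>2) / (2 * \<epsilon>\<^sup>2 * (1 - s)) \<le> s * (t * \<epsilon>\<^sup>2 * ?k) / (2 * \<epsilon>\<^sup>2 * (1 - s))"
      by (intro divide_right_mono energy) (use assms in auto)
    also have "\<dots> = ?k * (t * s / (1 - s)) / 2" using assms by (simp add: divide_simps)
    finally show ?thesis unfolding f_exp_def
      by (intro ennreal_leI) (simp add: algebra_simps diff_divide_distrib add_divide_distrib)
  qed
  finally show ?thesis .
qed

section \<open>Chernoff bounds for a single dimension\<close>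

text \<open>The normalising sum dominates each of its terms, in particular those at d and at d0. If
  the weights are not summable, \<open>post_dim\<close> is 0 by \<open>post_dim_eq\<close>.\<close>

lemma post_dim_le_ratio:
  assumes "\<epsilon> > 0" "\<kappa> > 0" "\<rho> > 0" "1 \<le> d" "1 \<le> d0"
  shows "post_dim \<epsilon> \<kappa> \<rho> x d \<le> min 1 (post_weight \<epsilon> \<kappa> \<rho> x d / post_weight \<epsilon> \<kappa> \<rho> x d0)"
proof -
  let ?w = "post_weight \<epsilon> \<kappa> \<rho> x"
  have w: "?w l > 0" for l by (simp add: post_weight_def)
  show ?thesis
  proof (cases "?w summable_on {1..}")
    case True
    have le: "?w l \<le> infsum ?w {1..}" if "1 \<le> l" for l
      using that finite_sum_le_infsum[OF True, of "{l}"] w by (auto simp: less_imp_le)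
    have "?w d / infsum ?w {1..} \<le> ?w d / ?w d0"
      using le[OF assms(5)] w less_le_trans[OF w le[OF assms(5)]]
      by (intro divide_left_mono) (auto simp: less_imp_le)
    moreover have "?w d / infsum ?w {1..} \<le> 1"
      using le[OF assms(4)] less_le_trans[OF w le[OF assms(4)]] by simp
    ultimately show ?thesis using True by (simp add: post_dim_eq[OF assms(1-4)])
  qed (use w in \<open>simp add: post_dim_eq[OF assms(1-4)] less_imp_le\<close>)
qed

text \<open>Only the block between the two dimensions survives. Its length is written as
  \<open>card\<close> to match \<open>nn_integral_exp_excess_le\<close> with J the block.\<close>

lemma post_weight_ratio:
  assumes "d \<le> e"
  shows "post_weight \<epsilon> \<kappa> \<rho> x e / post_weight \<epsilon> \<kappa> \<rho> x d
    = exp (((\<Sum>i=d+1..e. (x i)\<^sup>2) / \<epsilon>\<^sup>2 - A_const \<kappa> \<rho> * real (card {d+1..e})) / 2)"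
proof -
  have "(\<Sum>i=1..e. (x i)\<^sup>2) = (\<Sum>i=1..d. (x i)\<^sup>2) + (\<Sum>i=d+1..e. (x i)\<^sup>2)"
    using assms by (metis le_add_diff_inverse sum.ub_add_nat le_add2 add.commute)
  then show ?thesis unfolding post_weight_def exp_diff[symmetric] using assms
    by (simp add: of_nat_diff add_divide_distrib diff_divide_distrib algebra_simps)
qed

text \<open>The cap at 1 is what permits a power h < 1 of the ratio; at h = 1 the Gaussian moment
  would be infinite. For y \<ge> 0 the right side is at least 1, and for y < 0 shrinking y raises
  it.\<close>

lemma min_one_exp_le:
  fixes h y :: real
  assumes "0 \<le> h" "h \<le> 1"
  shows "min 1 (exp y) \<le> exp (h * y)"
proof (cases "y \<ge> 0")
  case False
  then have "1 * y \<le> h * y" using assms by (intro mult_right_mono_neg) auto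
  then show ?thesis by (simp add: min.coboundedI2)
qed (use assms in \<open>simp add: min.coboundedI1\<close>)

text \<open>The moment bound is used with s = h on the block above d0, for each h in [0,1), and then
  optimised by \<open>le_exp_cSUP\<close>.\<close>

lemma nn_integral_ratio_above_le:
  assumes "\<epsilon> > 0" "d0 < d"
    and "(\<Sum>i=d0+1..d. (\<theta> i)\<^sup>2) \<le> t * \<epsilon>\<^sup>2 * real (d - d0)"
  shows "(\<integral>\<^sup>+x. ennreal (min 1 (post_weight \<epsilon> \<kappa> \<rho> x d / post_weight \<epsilon> \<kappa> \<rho> x d0)) \<partial>seq_law \<epsilon> \<theta>)
    \<le> ennreal (exp (- real (d - d0) * f_opt (A_const \<kappa> \<rho>) t))"
  unfolding f_opt_def
proof (rule le_exp_cSUP)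
  fix h :: real assume h: "h \<in> {0..<1}"
  let ?J = "{d0+1..d}"
  have "(\<integral>\<^sup>+x. ennreal (min 1 (post_weight \<epsilon> \<kappa> \<rho> x d / post_weight \<epsilon> \<kappa> \<rho> x d0)) \<partial>seq_law \<epsilon> \<theta>)
    \<le> (\<integral>\<^sup>+x. ennreal (exp (h / 2 * ((\<Sum>i\<in>?J. (x i)\<^sup>2) / \<epsilon>\<^sup>2 - A_const \<kappa> \<rho> * real (card ?J)))) \<partial>seq_law \<epsilon> \<theta>)"
  proof (intro nn_integral_mono ennreal_leI)
    fix x
    show "min 1 (post_weight \<epsilon> \<kappa> \<rho> x d / post_weight \<epsilon> \<kappa> \<rho> x d0)
      \<le> exp (h / 2 * ((\<Sum>i\<in>?J. (x i)\<^sup>2) / \<epsilon>\<^sup>2 - A_const \<kappa> \<rho> * real (card ?J)))"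
      unfolding post_weight_ratio[OF less_imp_le[OF assms(2)]]
      using min_one_exp_le[of h "((\<Sum>i\<in>?J. (x i)\<^sup>2) / \<epsilon>\<^sup>2 - A_const \<kappa> \<rho> * real (card ?J)) / 2"] h
      by simp
  qed
  also have "\<dots> \<le> ennreal (exp (- real (card ?J) * f_exp h (A_const \<kappa> \<rho>) t))"
    by (rule nn_integral_exp_excess_le) (use assms h in \<open>auto intro: mult_left_mono\<close>)
  finally show "(\<integral>\<^sup>+x. ennreal (min 1 (post_weight \<epsilon> \<kappa> \<rho> x d / post_weight \<epsilon> \<kappa> \<rho> x d0)) \<partial>seq_law \<epsilon> \<theta>)
    \<le> ennreal (exp (- real (d - d0) * f_exp h (A_const \<kappa> \<rho>) t))" by simp
qed (use assms in auto)

text \<open>Here the weight ratio is the reciprocal of the block exponential, so s = - h. The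
  negative sign turns the lower energy bound into the hypothesis of
  \<open>nn_integral_exp_excess_le\<close>.\<close>

lemma nn_integral_ratio_below_le:
  assumes "\<epsilon> > 0" "d < d0"
    and "(\<Sum>i=d+1..d0. (\<theta> i)\<^sup>2) \<ge> t * \<epsilon>\<^sup>2 * real (d0 - d)"
  shows "(\<integral>\<^sup>+x. ennreal (min 1 (post_weight \<epsilon> \<kappa> \<rho> x d / post_weight \<epsilon> \<kappa> \<rho> x d0)) \<partial>seq_law \<epsilon> \<theta>)
    \<le> ennreal (exp (- real (d0 - d) * g_opt (A_const \<kappa> \<rho>) t))"
  unfolding g_opt_def
proof (rule le_exp_cSUP)
  fix h :: real assume h: "h \<in> {0..<1}"
  let ?J = "{d+1..d0}"
  have "(\<integral>\<^sup>+x. ennreal (min 1 (post_weight \<epsilon> \<kappa> \<rho> x d / post_weight \<epsilon> \<kappa> \<rho> x d0)) \<partial>seq_law \<epsilon> \<theta>)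
    \<le> (\<integral>\<^sup>+x. ennreal (exp (- h / 2 * ((\<Sum>i\<in>?J. (x i)\<^sup>2) / \<epsilon>\<^sup>2 - A_const \<kappa> \<rho> * real (card ?J)))) \<partial>seq_law \<epsilon> \<theta>)"
  proof (intro nn_integral_mono ennreal_leI)
    fix x
    let ?Q = "((\<Sum>i\<in>?J. (x i)\<^sup>2) / \<epsilon>\<^sup>2 - A_const \<kappa> \<rho> * real (card ?J)) / 2"
    have "post_weight \<epsilon> \<kappa> \<rho> x d / post_weight \<epsilon> \<kappa> \<rho> x d0 = exp (- ?Q)"
      using post_weight_ratio[OF less_imp_le[OF assms(2)], of \<epsilon> \<kappa> \<rho> x]
      by (metis exp_minus inverse_divide)
    then show "min 1 (post_weight \<epsilon> \<kappa> \<rho> x d / post_weight \<epsilon> \<kappa> \<rho> x d0)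
      \<le> exp (- h / 2 * ((\<Sum>i\<in>?J. (x i)\<^sup>2) / \<epsilon>\<^sup>2 - A_const \<kappa> \<rho> * real (card ?J)))"
      using min_one_exp_le[of h "- ?Q"] h by simp
  qed
  also have "\<dots> \<le> ennreal (exp (- real (card ?J) * f_exp (- h) (A_const \<kappa> \<rho>) t))"
    by (rule nn_integral_exp_excess_le) (use assms h in \<open>auto intro: mult_left_mono\<close>)
  finally show "(\<integral>\<^sup>+x. ennreal (min 1 (post_weight \<epsilon> \<kappa> \<rho> x d / post_weight \<epsilon> \<kappa> \<rho> x d0)) \<partial>seq_law \<epsilon> \<theta>)
    \<le> ennreal (exp (- real (d0 - d) * g_exp h (A_const \<kappa> \<rho>) t))" by (simp add: g_exp_def)
qed (use assms in auto)

lemma measurable_post_weight [measurable]: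
  "(\<lambda>x. post_weight \<epsilon> \<kappa> \<rho> x d) \<in> borel_measurable (seq_law \<epsilon>' \<theta>)"
proof -
  have "(\<lambda>x. \<Sum>i=1..d. (x i)\<^sup>2) \<in> borel_measurable (seq_law \<epsilon>' \<theta>)"
    by (intro borel_measurable_sum borel_measurable_power measurable_seq_law_component) simp
  then show ?thesis unfolding post_weight_def by measurable
qed

section \<open>Summation over all excluded dimensions\<close>

text \<open>Common core of both claims: the energy levels t above d0 and H below d0 are kept
  separate, to be chosen as (t0, \<tau>) under the tail condition and (\<tau>, H0) under the head
  condition.\<close>

lemma nn_integral_post_notin_le:
  fixes \<epsilon> \<kappa> \<rho> t H :: real and d0 n1 n2 :: nat
  defines "\<alpha> \<equiv> f_opt (A_const \<kappa> \<rho>) t" and "\<beta> \<equiv> g_opt (A_const \<kappa> \<rho>) H"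
  assumes "\<epsilon> > 0" "\<kappa> > 0" "\<rho> > 0" "1 \<le> d0" "\<alpha> > 0" "\<beta> > 0"
    and tail: "\<And>d. d0 + n2 < d \<Longrightarrow> (\<Sum>i=d0+1..d. (\<theta> i)\<^sup>2) \<le> t * \<epsilon>\<^sup>2 * real (d - d0)"
    and head: "\<And>d. 1 \<le> d \<Longrightarrow> d + n1 < d0 \<Longrightarrow> H * \<epsilon>\<^sup>2 * real (d0 - d) \<le> (\<Sum>i=d+1..d0. (\<theta> i)\<^sup>2)"
  shows "(\<integral>\<^sup>+x. post_notin \<epsilon> \<kappa> \<rho> x {int d0 - int n1..int d0 + int n2} \<partial>seq_law \<epsilon> \<theta>)
    \<le> ennreal (1 / \<alpha> * exp (- \<alpha> * real n2) + 1 / \<beta> * exp (- \<beta> * real n1))"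
proof -
  let ?I = "{d. 1 \<le> d \<and> int d \<notin> {int d0 - int n1..int d0 + int n2}}"
  let ?U = "{d. d0 + n2 < d}" and ?L = "{d. 1 \<le> d \<and> d + n1 < d0}"
  \<comment> \<open>A measurable majorant of \<open>post_dim\<close>: monotonicity brings it in
    first, and only then are sum and integral exchanged.\<close>
  define u where "u d x = ennreal (min 1 (post_weight \<epsilon> \<kappa> \<rho> x d / post_weight \<epsilon> \<kappa> \<rho> x d0))" for d x
  define v where "v d = (if d \<in> ?U then exp (- \<alpha> * real (d - d0)) else 0) +
      (if d \<in> ?L then exp (- \<beta> * real (d0 - d)) else 0)" for d
  have v: "v d \<ge> 0" for d by (simp add: v_def)
  have [measurable]: "u d \<in> borel_measurable (seq_law \<epsilon> \<theta>)" for d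
    unfolding u_def by measurable
  have "(\<integral>\<^sup>+x. post_notin \<epsilon> \<kappa> \<rho> x {int d0 - int n1..int d0 + int n2} \<partial>seq_law \<epsilon> \<theta>)
    \<le> (\<integral>\<^sup>+x. (\<Sum>d. if d \<in> ?I then u d x else 0) \<partial>seq_law \<epsilon> \<theta>)"
    unfolding post_notin_def infsum_ennreal_eq_suminf u_def
    by (intro nn_integral_mono suminf_le) (use assms in \<open>auto intro!: ennreal_leI post_dim_le_ratio simp del: min_less_iff_conj\<close>)
  also have "\<dots> = (\<Sum>d. \<integral>\<^sup>+x. (if d \<in> ?I then u d x else 0) \<partial>seq_law \<epsilon> \<theta>)"
    by (intro nn_integral_suminf) measurable
  also have "\<dots> \<le> (\<Sum>d. ennreal (v d))"
  proof (intro suminf_le)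
    fix d
    \<comment> \<open>An excluded d lies above or below the interval. If the integer left end is not
      positive, no d \<ge> 1 satisfies d + n1 < d0 and the lower case is void.\<close>
    consider (U) "d \<in> ?I" "d0 + n2 < d" | (L) "1 \<le> d" "d + n1 < d0" | (N) "d \<notin> ?I" by force
    then show "(\<integral>\<^sup>+x. (if d \<in> ?I then u d x else 0) \<partial>seq_law \<epsilon> \<theta>) \<le> ennreal (v d)"
    proof cases
      case U
      then have "v d = exp (- real (d - d0) * \<alpha>)" by (simp add: v_def algebra_simps)
      then show ?thesis using U nn_integral_ratio_above_le[OF assms(3) _ tail[of d]]
        by (simp add: u_def \<alpha>_def)
    next
      case L
      then have "v d = exp (- real (d0 - d) * \<beta>)" "d \<in> ?I" by (simp_all add: v_def algebra_simps)
      then show ?thesis using L nn_integral_ratio_below_le[OF assms(3) _ head[of d]]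
        by (simp add: u_def \<beta>_def)
    qed (auto simp: v)
  qed auto
  also have "\<dots> \<le> ennreal (1 / \<alpha> * exp (- \<alpha> * real n2) + 1 / \<beta> * exp (- \<beta> * real n1))"
  proof (rule suminf_le_const)
    fix n
    have "(\<Sum>d<n. if d \<in> ?U then exp (- \<alpha> * real (d - d0)) else 0)
      = (\<Sum>d\<in>{..<n} \<inter> ?U. exp (- \<alpha> * real (d - d0)))"
      by (subst sum.inter_restrict) auto
    \<comment> \<open>Reindex by the distance to d0; truncated subtraction is injective on this side
      of d0. The strict d0 + n2 < d gives k > n2, as \<open>sum_exp_tail_le\<close> demands.\<close>
    also have "\<dots> = (\<Sum>k\<in>(\<lambda>d. d - d0) ` ({..<n} \<inter> ?U). exp (- \<alpha> * real k))"
      by (subst sum.reindex) (auto simp: inj_on_def)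
    also have "\<dots> \<le> 1 / \<alpha> * exp (- \<alpha> * real n2)"
      by (rule sum_exp_tail_le) (use assms in auto)
    finally have U: "(\<Sum>d<n. if d \<in> ?U then exp (- \<alpha> * real (d - d0)) else 0) \<le> 1 / \<alpha> * exp (- \<alpha> * real n2)" .
    have "(\<Sum>d<n. if d \<in> ?L then exp (- \<beta> * real (d0 - d)) else 0)
      = (\<Sum>d\<in>{..<n} \<inter> ?L. exp (- \<beta> * real (d0 - d)))"
      by (subst sum.inter_restrict) auto
    also have "\<dots> = (\<Sum>k\<in>(\<lambda>d. d0 - d) ` ({..<n} \<inter> ?L). exp (- \<beta> * real k))"
      by (subst sum.reindex) (auto simp: inj_on_def)
    also have "\<dots> \<le> 1 / \<beta> * exp (- \<beta> * real n1)"
      by (rule sum_exp_tail_le) (use assms in auto)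
    finally have L: "(\<Sum>d<n. if d \<in> ?L then exp (- \<beta> * real (d0 - d)) else 0) \<le> 1 / \<beta> * exp (- \<beta> * real n1)" .
    have "(\<Sum>d<n. v d) \<le> 1 / \<alpha> * exp (- \<alpha> * real n2) + 1 / \<beta> * exp (- \<beta> * real n1)"
      unfolding v_def sum.distrib using U L by (rule add_mono)
    then show "(\<Sum>d<n. ennreal (v d)) \<le> ennreal (1 / \<alpha> * exp (- \<alpha> * real n2) + 1 / \<beta> * exp (- \<beta> * real n1))"
      by (simp add: v sum_ennreal ennreal_leI)
  qed auto
  finally show ?thesis .
qed

section \<open>Energy of \<theta> on either side of the effective dimension\<close>

text \<open>The tail beyond e is common to both risks and cancels; square summability lets
  \<open>infsum\<close> split at e.\<close>

lemma risk_diff: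
  assumes "\<theta> \<in> ell2" "d \<le> e"
  shows "risk \<epsilon> \<tau> \<theta> d = risk \<epsilon> \<tau> \<theta> e + (\<Sum>i=d+1..e. (\<theta> i)\<^sup>2) - \<tau> * \<epsilon>\<^sup>2 * real (e - d)"
proof -
  have "(\<lambda>i. (\<theta> i)\<^sup>2) summable_on {e<..}"
    using assms unfolding ell2_def by (auto intro: summable_on_subset)
  then have "infsum (\<lambda>i. (\<theta> i)\<^sup>2) ({d+1..e} \<union> {e<..}) = (\<Sum>i=d+1..e. (\<theta> i)\<^sup>2) + infsum (\<lambda>i. (\<theta> i)\<^sup>2) {e<..}"
    by (subst infsum_Un_disjoint) auto
  moreover have "{d+1..e} \<union> {e<..} = {d<..}" using assms(2) by auto
  ultimately show ?thesis using assms(2) by (simp add: risk_def of_nat_diff algebra_simps)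
qed

text \<open>Compare the minimal risk with that of a competitor d: going up from d0 cannot save more
  energy than it costs, and going down cannot save more cost than the energy it gives up.\<close>

lemma effective_dim_energy:
  assumes "\<theta> \<in> ell2" "is_effective_dim \<epsilon> \<tau> \<theta> d0"
  shows effective_dim_ge_1: "1 \<le> d0"
    and effective_dim_tail: "d0 \<le> d \<Longrightarrow> (\<Sum>i=d0+1..d. (\<theta> i)\<^sup>2) \<le> \<tau> * \<epsilon>\<^sup>2 * real (d - d0)"
    and effective_dim_head: "1 \<le> d \<Longrightarrow> d \<le> d0 \<Longrightarrow> \<tau> * \<epsilon>\<^sup>2 * real (d0 - d) \<le> (\<Sum>i=d+1..d0. (\<theta> i)\<^sup>2)"
proof -
  have d0: "1 \<le> d0" and min: "\<And>d. 1 \<le> d \<Longrightarrow> risk \<epsilon> \<tau> \<theta> d0 \<le> risk \<epsilon> \<tau> \<theta> d"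
    using assms(2) by (auto simp: is_effective_dim_def is_arg_min_def not_less)
  show "1 \<le> d0" by fact
  show "(\<Sum>i=d0+1..d. (\<theta> i)\<^sup>2) \<le> \<tau> * \<epsilon>\<^sup>2 * real (d - d0)" if "d0 \<le> d"
    using min[of d] d0 that risk_diff[OF assms(1) that, of \<epsilon> \<tau>] by simp
  show "\<tau> * \<epsilon>\<^sup>2 * real (d0 - d) \<le> (\<Sum>i=d+1..d0. (\<theta> i)\<^sup>2)" if "1 \<le> d" "d \<le> d0"
    using min[of d] that risk_diff[OF assms(1) that(2), of \<epsilon> \<tau>] by simp
qed

theorem theorem4:
  fixes \<epsilon> \<kappa> \<rho> :: real and dtau :: "real \<Rightarrow> (nat \<Rightarrow> real) \<Rightarrow> nat"
  assumes "\<epsilon> > 0" and "\<kappa> > 0" and "\<rho> > 0"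
    and "\<forall>\<tau>>0. \<forall>\<theta>\<in>ell2. is_effective_dim \<epsilon> \<tau> \<theta> (dtau \<tau> \<theta>)"
  shows
    "(\<forall>\<tau> t0 N0 :: real. \<forall>n1 n2 :: nat.
        \<tau> > 0 \<and> t0 > 0 \<and> 1 + t0 < A_const \<kappa> \<rho> \<and> A_const \<kappa> \<rho> < 1 + \<tau> \<and> N0 > 0 \<and> real n2 \<ge> N0 \<longrightarrow>
        (let \<alpha> = f_opt (A_const \<kappa> \<rho>) t0; \<beta> = g_opt (A_const \<kappa> \<rho>) \<tau> in
         \<alpha> > 0 \<and> \<beta> > 0 \<and>
         (SUP \<theta>\<in>tail_class \<epsilon> dtau \<tau> t0 N0.
            \<integral>\<^sup>+x. post_notin \<epsilon> \<kappa> \<rho> x {int (dtau \<tau> \<theta>) - int n1..int (dtau \<tau> \<theta>) + int n2} \<partial>seq_law \<epsilon> \<theta>)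
         \<le> ennreal (1 / \<alpha> * exp (- \<alpha> * real n2) + 1 / \<beta> * exp (- \<beta> * real n1)))) \<and>
     (\<forall>\<tau> H0 n0 :: real. \<forall>n1 n2 :: nat.
        \<tau> > 0 \<and> H0 > 0 \<and> 1 + \<tau> < A_const \<kappa> \<rho> \<and> A_const \<kappa> \<rho> < 1 + H0 \<and> n0 > 0 \<and> real n1 \<ge> n0 \<longrightarrow>
        (let \<alpha> = f_opt (A_const \<kappa> \<rho>) \<tau>; \<beta> = g_opt (A_const \<kappa> \<rho>) H0 in
         \<alpha> > 0 \<and> \<beta> > 0 \<and>
         (SUP \<theta>\<in>head_class \<epsilon> dtau \<tau> H0 n0.
            \<integral>\<^sup>+x. post_notin \<epsilon> \<kappa> \<rho> x {int (dtau \<tau> \<theta>) - int n1..int (dtau \<tau> \<theta>) + int n2} \<partial>seq_law \<epsilon> \<theta>)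
         \<le> ennreal (1 / \<alpha> * exp (- \<alpha> * real n2) + 1 / \<beta> * exp (- \<beta> * real n1))))"
proof -
  have A: "A_const \<kappa> \<rho> > 0" using assms by (simp add: A_const_def add_pos_pos)
  have dim: "is_effective_dim \<epsilon> \<tau> \<theta> (dtau \<tau> \<theta>)" if "\<tau> > 0" "\<theta> \<in> ell2" for \<tau> \<theta>
    using assms(4) that by blast
  \<comment> \<open>Above the effective dimension the tail condition supplies the energy bound with
    t0; below it, minimality supplies the bound with \<tau>.\<close>
  have I: "f_opt (A_const \<kappa> \<rho>) t0 > 0 \<and> g_opt (A_const \<kappa> \<rho>) \<tau> > 0 \<and>
      (SUP \<theta>\<in>tail_class \<epsilon> dtau \<tau> t0 N0.
        \<integral>\<^sup>+x. post_notin \<epsilon> \<kappa> \<rho> x {int (dtau \<tau> \<theta>) - int n1..int (dtau \<tau> \<theta>) + int n2} \<partial>seq_law \<epsilon> \<theta>)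
      \<le> ennreal (1 / f_opt (A_const \<kappa> \<rho>) t0 * exp (- f_opt (A_const \<kappa> \<rho>) t0 * real n2)
        + 1 / g_opt (A_const \<kappa> \<rho>) \<tau> * exp (- g_opt (A_const \<kappa> \<rho>) \<tau> * real n1))"
    if h: "\<tau> > 0" "t0 > 0" "1 + t0 < A_const \<kappa> \<rho>" "A_const \<kappa> \<rho> < 1 + \<tau>" "real n2 \<ge> N0"
    for \<tau> t0 N0 and n1 n2 :: nat
  proof (intro conjI SUP_least)
    show pos: "f_opt (A_const \<kappa> \<rho>) t0 > 0" "g_opt (A_const \<kappa> \<rho>) \<tau> > 0"
      using f_opt_pos g_opt_pos A h by auto
    fix \<theta> assume \<theta>: "\<theta> \<in> tail_class \<epsilon> dtau \<tau> t0 N0"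
    then have l2: "\<theta> \<in> ell2" by (simp add: tail_class_def)
    note eff = effective_dim_energy[OF l2 dim[OF h(1) l2]]
    show "(\<integral>\<^sup>+x. post_notin \<epsilon> \<kappa> \<rho> x {int (dtau \<tau> \<theta>) - int n1..int (dtau \<tau> \<theta>) + int n2} \<partial>seq_law \<epsilon> \<theta>)
      \<le> ennreal (1 / f_opt (A_const \<kappa> \<rho>) t0 * exp (- f_opt (A_const \<kappa> \<rho>) t0 * real n2)
        + 1 / g_opt (A_const \<kappa> \<rho>) \<tau> * exp (- g_opt (A_const \<kappa> \<rho>) \<tau> * real n1))"
    proof (rule nn_integral_post_notin_le[OF assms(1-3) eff(1) pos])
      \<comment> \<open>The block length k exceeds n2 \<ge> N0, so the tail condition applies to
        it.\<close>
      fix d assume d: "dtau \<tau> \<theta> + n2 < d"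
      then obtain k where "d = dtau \<tau> \<theta> + k" "k > n2"
        by (metis add_less_cancel_left less_imp_add_positive add.assoc less_add_same_cancel1)
      then show "(\<Sum>i=dtau \<tau> \<theta> + 1..d. (\<theta> i)\<^sup>2) \<le> t0 * \<epsilon>\<^sup>2 * real (d - dtau \<tau> \<theta>)"
        using \<theta> h(5) by (auto simp: tail_class_def)
    qed (use eff(3) in auto)
  qed
  \<comment> \<open>The roles are exchanged: minimality controls the side above with \<tau>, the
    head condition the side below with H0.\<close>
  have II: "f_opt (A_const \<kappa> \<rho>) \<tau> > 0 \<and> g_opt (A_const \<kappa> \<rho>) H0 > 0 \<and>
      (SUP \<theta>\<in>head_class \<epsilon> dtau \<tau> H0 n0.
        \<integral>\<^sup>+x. post_notin \<epsilon> \<kappa> \<rho> x {int (dtau \<tau> \<theta>) - int n1..int (dtau \<tau> \<theta>) + int n2} \<partial>seq_law \<epsilon> \<theta>)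
      \<le> ennreal (1 / f_opt (A_const \<kappa> \<rho>) \<tau> * exp (- f_opt (A_const \<kappa> \<rho>) \<tau> * real n2)
        + 1 / g_opt (A_const \<kappa> \<rho>) H0 * exp (- g_opt (A_const \<kappa> \<rho>) H0 * real n1))"
    if h: "\<tau> > 0" "H0 > 0" "1 + \<tau> < A_const \<kappa> \<rho>" "A_const \<kappa> \<rho> < 1 + H0" "real n1 \<ge> n0"
    for \<tau> H0 n0 and n1 n2 :: nat
  proof (intro conjI SUP_least)
    show pos: "f_opt (A_const \<kappa> \<rho>) \<tau> > 0" "g_opt (A_const \<kappa> \<rho>) H0 > 0"
      using f_opt_pos g_opt_pos A h by auto
    fix \<theta> assume \<theta>: "\<theta> \<in> head_class \<epsilon> dtau \<tau> H0 n0"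
    then have l2: "\<theta> \<in> ell2" by (simp add: head_class_def)
    note eff = effective_dim_energy[OF l2 dim[OF h(1) l2]]
    show "(\<integral>\<^sup>+x. post_notin \<epsilon> \<kappa> \<rho> x {int (dtau \<tau> \<theta>) - int n1..int (dtau \<tau> \<theta>) + int n2} \<partial>seq_law \<epsilon> \<theta>)
      \<le> ennreal (1 / f_opt (A_const \<kappa> \<rho>) \<tau> * exp (- f_opt (A_const \<kappa> \<rho>) \<tau> * real n2)
        + 1 / g_opt (A_const \<kappa> \<rho>) H0 * exp (- g_opt (A_const \<kappa> \<rho>) H0 * real n1))"
    proof (rule nn_integral_post_notin_le[OF assms(1-3) eff(1) pos])
      fix d assume d: "1 \<le> d" "d + n1 < dtau \<tau> \<theta>"
      \<comment> \<open>The head condition is stated by block length: k exceeds n1 \<ge> n0, and a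
        block of length k ending at the effective dimension starts at d + 1.\<close>
      define k where "k = dtau \<tau> \<theta> - d"
      have k: "1 \<le> k" "k \<le> dtau \<tau> \<theta>" "real k \<ge> n0" "d = dtau \<tau> \<theta> - k"
        using d h(5) by (auto simp: k_def)
      then have "H0 * \<epsilon>\<^sup>2 * real k \<le> (\<Sum>i=dtau \<tau> \<theta> - k + 1..dtau \<tau> \<theta>. (\<theta> i)\<^sup>2)"
        using \<theta> unfolding head_class_def by blast
      then show "H0 * \<epsilon>\<^sup>2 * real (dtau \<tau> \<theta> - d) \<le> (\<Sum>i=d+1..dtau \<tau> \<theta>. (\<theta> i)\<^sup>2)"
        using k by simp
    qed (use eff(2) in auto)
  qed
  show ?thesis unfolding Let_def using I II by blast
qed

end
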